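(* Let $D\subseteq\mathbb R$ be a nonempty open interval and $J\in C^2(D;\mathbb R)$. Let $\varphi_2\in C^1(\mathbb R;\mathbb R)$ be any given function, let $g_1,g_2\in C^1(\mathbb R;\mathbb R)$ satisfy $$[g_1\circ J,\,g_2\circ J](x)=-\varphi_2(J(x))\,J'(x)\quad\text{for all }x\in D,$$ and let $g_3=-\varphi_2$. Then, for all $x\in D$, $$\big[[g_1\circ J,\,g_2\circ J],\,g_3\circ J\big](x)=-\big(\varphi_2(J(x))\big)^2\,J''(x).$$
   Context: For scalar functions $f,g$ on $D\subseteq\mathbb R$, the Lie derivative of $f$ along $g$ is $L_gf(x)=\lim_{s\to0}\frac{f(x+sg(x))-f(x)}{s}=f'(x)g(x)$, and the Lie bracket is $[f,g](x)=L_fg(x)-L_gf(x)=g'(x)f(x)-f'(x)g(x)$. *)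

theory Defs
  imports "HOL-Analysis.Analysis"
begin

definition lie_deriv :: "(real \<Rightarrow> real) \<Rightarrow> (real \<Rightarrow> real) \<Rightarrow> real \<Rightarrow> real"
  where "lie_deriv g f x = Lim (at 0) (\<lambda>s. (f (x + s * g x) - f x) / s)"

definition lie_bracket :: "(real \<Rightarrow> real) \<Rightarrow> (real \<Rightarrow> real) \<Rightarrow> real \<Rightarrow> real"
  where "lie_bracket f g x = lie_deriv f g x - lie_deriv g f x"

(* Intended for open S: C1_differentiable_on uses two-sided derivatives at the points of S,
   so only the values of f near points of S matter. *)
definition C2_differentiable_on :: "(real \<Rightarrow> real) \<Rightarrow> real set \<Rightarrow> bool"
    (infix "C2'_differentiable'_on" 50)
  where "f C2_differentiable_on S \<longleftrightarrow>
    f C1_differentiable_on S \<and> deriv f C1_differentiable_on S"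

lemma tendsto_lie_deriv:
  fixes f g :: "real \<Rightarrow> real"
  assumes "f differentiable at x"
  shows "((\<lambda>s. (f (x + s * g x) - f x) / s) \<longlongrightarrow> deriv f x * g x) (at 0)"
proof -
  have f: "(f has_real_derivative deriv f x) (at (x + 0 * g x))"
    using assms by (simp add: DERIV_deriv_iff_real_differentiable)
  have "((\<lambda>s. x + s * g x) has_real_derivative g x) (at 0)"
    by (auto intro!: derivative_eq_intros)
  from DERIV_chain2[OF f this] show ?thesis
    by (simp add: DERIV_def)
qed

lemma lie_deriv_eq:
  fixes f g :: "real \<Rightarrow> real"
  assumes "f differentiable at x"
  shows "lie_deriv g f x = deriv f x * g x"
  unfolding lie_deriv_def
  by (rule tendsto_Lim[OF _ tendsto_lie_deriv[OF assms]]) simp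

lemma lie_bracket_eq:
  assumes "f differentiable at x" "g differentiable at x"
  shows "lie_bracket f g x = deriv g x * f x - deriv f x * g x"
  by (simp add: lie_bracket_def lie_deriv_eq assms)

end

theory Submission
  imports Defs
begin

text \<open>Write \<open>p\<close> for \<open>\<phi>\<^sub>2\<close>. By hypothesis the inner
  bracket equals F = -p(J) J' on \<open>D\<close>, and G = \<open>g\<^sub>3 \<circ> J\<close> is
  -p(J). The chain and product rules give F' = -(p'(J) J'^2 + p(J) J'') and G' = -p'(J) J'. In
  [F, G] = G' F - F' G the terms with p'(J) cancel, leaving -p(J)^2 J''.\<close>

lemma C1_differentiable_on_imp_DERIV:
  fixes f :: "real \<Rightarrow> real"
  assumes "f C1_differentiable_on S" "x \<in> S"
  shows "(f has_real_derivative deriv f x) (at x)"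
  using assms
  by (auto simp: C1_differentiable_on_def DERIV_deriv_iff_real_differentiable
      dest: differentiableI_vector)

text \<open>Lets explicitly computed derivatives be substituted into the bracket, which is defined
  through limits.\<close>

lemma lie_bracket_DERIV:
  assumes "(f has_real_derivative f') (at x)" "(g has_real_derivative g') (at x)"
  shows "lie_bracket f g x = g' * f x - f' * g x"
  using assms
  by (subst lie_bracket_eq) (auto simp: DERIV_imp_deriv real_differentiable_def)

theorem lemma3:
  fixes D :: "real set" and J \<phi>\<^sub>2 g\<^sub>1 g\<^sub>2 g\<^sub>3 :: "real \<Rightarrow> real"
  assumes "open D" and "is_interval D" and "D \<noteq> {}"
    and "J C2_differentiable_on D"
    and "\<phi>\<^sub>2 C1_differentiable_on UNIV"
    and "g\<^sub>1 C1_differentiable_on UNIV" and "g\<^sub>2 C1_differentiable_on UNIV"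
    and "\<forall>x\<in>D. lie_bracket (g\<^sub>1 \<circ> J) (g\<^sub>2 \<circ> J) x = - \<phi>\<^sub>2 (J x) * deriv J x"
    and "g\<^sub>3 = (\<lambda>y. - \<phi>\<^sub>2 y)"
  shows "\<forall>x\<in>D. lie_bracket (lie_bracket (g\<^sub>1 \<circ> J) (g\<^sub>2 \<circ> J)) (g\<^sub>3 \<circ> J) x
           = - (\<phi>\<^sub>2 (J x))\<^sup>2 * deriv (deriv J) x"
proof
  fix x assume x: "x \<in> D"
  let ?F = "lie_bracket (g\<^sub>1 \<circ> J) (g\<^sub>2 \<circ> J)"
  let ?G = "\<lambda>y. - \<phi>\<^sub>2 (J y) * deriv J y"
  let ?\<phi>' = "deriv \<phi>\<^sub>2 (J x)"
  have J: "(J has_real_derivative deriv J x) (at x)"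
    and J': "(deriv J has_real_derivative deriv (deriv J) x) (at x)"
    using assms(4) x by (auto simp: C2_differentiable_on_def C1_differentiable_on_imp_DERIV)
  have "(\<phi>\<^sub>2 has_real_derivative ?\<phi>') (at (J x))"
    using assms(5) by (rule C1_differentiable_on_imp_DERIV) simp
  from DERIV_chain2[OF this J]
  have \<phi>J: "((\<lambda>y. \<phi>\<^sub>2 (J y)) has_real_derivative ?\<phi>' * deriv J x) (at x)" .
  have G: "(?G has_real_derivative
      - (?\<phi>' * (deriv J x)\<^sup>2 + \<phi>\<^sub>2 (J x) * deriv (deriv J) x)) (at x)"
    by (auto intro!: derivative_eq_intros \<phi>J J' simp: power2_eq_square algebra_simps)
  \<comment> \<open>The bracket \<open>?F\<close> is known to agree with \<open>?G\<close> only on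
    \<open>D\<close>; since \<open>D\<close> is open, they agree near \<open>x\<close>, so the
    derivative carries over.\<close>
  have F: "(?F has_real_derivative
      - (?\<phi>' * (deriv J x)\<^sup>2 + \<phi>\<^sub>2 (J x) * deriv (deriv J) x)) (at x)"
    by (rule has_field_derivative_transform_within_open[OF G assms(1) x])
      (simp add: assms(8))
  have g: "((g\<^sub>3 \<circ> J) has_real_derivative - (?\<phi>' * deriv J x)) (at x)"
    unfolding assms(9) comp_def by (rule DERIV_minus[OF \<phi>J])
  \<comment> \<open>The hypothesis is used again, now for the value of \<open>?F\<close> at
    \<open>x\<close>; both products then contain
    \<open>\<phi>\<^sub>2 (J x) * ?\<phi>' * (deriv J x)\<^sup>2\<close>, which cancels.\<close>
  show "lie_bracket ?F (g\<^sub>3 \<circ> J) x = - (\<phi>\<^sub>2 (J x))\<^sup>2 * deriv (deriv J) x"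
    unfolding lie_bracket_DERIV[OF F g] using assms(8) x
    by (simp add: assms(9) power2_eq_square algebra_simps)
qed

end
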